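(* Let $\Delta t>0$, let $a>0$ and $b,c\in\mathbb{R}$, and consider the three points $(0,a)$, $(\Delta t/2,b)$ and $(\Delta t,c)$. Set $$A=e^{\frac{2a^{2}}{\Delta t}},\qquad B=e^{-\frac{4ab}{\Delta t}},\qquad C=e^{-\frac{2ac}{\Delta t}}.$$ If $$\frac{1}{A^{2}}<\frac{B}{C}<\frac{1}{A}+\frac{\sqrt{A^{2}-1}}{A^{2}},$$ then there is a unique Daniels curve on $[0,\Delta t]$ passing through the three points, and its parameters are $$\alpha=2a,\qquad \beta=\frac{A\left(A^{4}B^{2}-C^{2}\right)}{A^{3}B-C},\qquad \gamma=A^{4}C^{2}-\beta A^{3}C.$$
   Context: A Daniels curve on $[0,\Delta t]$ with parameters $(\alpha,\beta,\gamma)$ is the function $$S(t)=\frac{\alpha}{2}-\frac{t}{\alpha}\ln\left[\frac{\beta+\sqrt{\beta^{2}+4\gamma e^{-\alpha^{2}/t}}}{2}\right],$$ where $\alpha>0$, $\beta>0$, $\gamma\in\mathbb{R}$ and $\lim_{t\to\Delta t}\left(\beta^{2}+4\gamma e^{-\alpha^{2}/t}\right)>0$. At $t=0$ the value is understood as the limit $S(0)=\alpha/2$. The curve passes through a point $(t_0,y_0)$ if $S(t_0)=y_0$. Uniqueness is among all parameter triples $(\alpha,\beta,\gamma)$ satisfying these constraints. *)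

theory Defs
  imports Complex_Main
begin

definition daniels_disc :: "real \<Rightarrow> real \<Rightarrow> real \<Rightarrow> real \<Rightarrow> real" where
  "daniels_disc \<alpha> \<beta> \<gamma> t = \<beta>\<^sup>2 + 4 * \<gamma> * exp (- (\<alpha>\<^sup>2 / t))"

(* The limit condition also keeps the argument of the square root positive on all of (0, T],
   since that argument is monotone in t with limit \<beta>\<^sup>2 > 0 at 0. *)
definition daniels_params :: "real \<Rightarrow> real \<Rightarrow> real \<Rightarrow> real \<Rightarrow> bool" where
  "daniels_params T \<alpha> \<beta> \<gamma> \<longleftrightarrow>
     \<alpha> > 0 \<and> \<beta> > 0 \<and> (\<exists>L>0. (daniels_disc \<alpha> \<beta> \<gamma> \<longlongrightarrow> L) (at_left T))"

definition daniels_curve :: "real \<Rightarrow> real \<Rightarrow> real \<Rightarrow> real \<Rightarrow> real" where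
  "daniels_curve \<alpha> \<beta> \<gamma> t =
     (if t = 0 then \<alpha> / 2
      else \<alpha> / 2 - t / \<alpha> * ln ((\<beta> + sqrt (daniels_disc \<alpha> \<beta> \<gamma> t)) / 2))"

(* The value prescribed at 0 is the limit of the formula. *)
lemma daniels_curve_tendsto_0:
  assumes "\<alpha> > 0" "\<beta> > 0"
  shows "(daniels_curve \<alpha> \<beta> \<gamma> \<longlongrightarrow> daniels_curve \<alpha> \<beta> \<gamma> 0) (at_right 0)"
proof -
  have "filterlim (\<lambda>t::real. \<alpha>\<^sup>2 * inverse t) at_top (at_right 0)"
    by (rule filterlim_tendsto_pos_mult_at_top[OF tendsto_const _ filterlim_inverse_at_top_right])
       (use assms in simp)
  then have "((\<lambda>t. exp (- (\<alpha>\<^sup>2 / t))) \<longlongrightarrow> 0) (at_right 0)"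
    by (intro filterlim_compose[OF exp_at_bot])
       (simp add: filterlim_uminus_at_bot divide_inverse)
  then have "(daniels_disc \<alpha> \<beta> \<gamma> \<longlongrightarrow> \<beta>\<^sup>2 + 4 * \<gamma> * 0) (at_right 0)"
    unfolding daniels_disc_def by (intro tendsto_intros)
  then have "((\<lambda>t. \<alpha> / 2 - t / \<alpha> * ln ((\<beta> + sqrt (daniels_disc \<alpha> \<beta> \<gamma> t)) / 2))
      \<longlongrightarrow> \<alpha> / 2 - 0 / \<alpha> * ln ((\<beta> + sqrt (\<beta>\<^sup>2 + 4 * \<gamma> * 0)) / 2)) (at_right 0)"
    using assms by (intro tendsto_intros) auto
  then have "((\<lambda>t. \<alpha> / 2 - t / \<alpha> * ln ((\<beta> + sqrt (daniels_disc \<alpha> \<beta> \<gamma> t)) / 2))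
      \<longlongrightarrow> daniels_curve \<alpha> \<beta> \<gamma> 0) (at_right 0)"
    by (simp add: daniels_curve_def)
  then show ?thesis
    by (rule Lim_transform_eventually)
       (auto simp: eventually_at_filter daniels_curve_def)
qed

definition daniels_through ::
  "real \<Rightarrow> (real \<times> real) set \<Rightarrow> real \<times> real \<times> real \<Rightarrow> bool" where
  "daniels_through T P = (\<lambda>(\<alpha>, \<beta>, \<gamma>).
     daniels_params T \<alpha> \<beta> \<gamma> \<and> (\<forall>(t, y)\<in>P. daniels_curve \<alpha> \<beta> \<gamma> t = y))"

end

theory Submission
  imports Defs
begin

text \<open>
  The value at \<open>0\<close> forces \<open>\<alpha> = 2 * a\<close>. For a fixed positive time \<open>t\<close>, exponentiating the equation
  \<open>S(t) = y\<close> turns it into the statement that \<open>X = exp (\<alpha> (\<alpha>/2 - y) / t)\<close> is the larger root of the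
  quadratic \<open>X\<^sup>2 = \<beta> X + \<gamma> exp (-\<alpha>\<^sup>2/t)\<close> (lemma \<open>daniels_curve_eq_iff\<close>). With \<open>\<alpha> = 2 * a\<close> the
  numbers that arise at \<open>T\<close> and \<open>T/2\<close> are \<open>X = A C\<close>, \<open>X = A\<^sup>2 B\<close> and \<open>exp (-\<alpha>\<^sup>2/t) = 1/A\<^sup>2\<close>,
  \<open>1/A\<^sup>4\<close>. Both quadratic equations are linear in \<open>(\<beta>, \<gamma>)\<close>, so interpolation is a linear
  \<open>2 \<times> 2\<close> system together with the sign conditions that select the larger roots
  (lemma \<open>daniels_through_iff_system\<close>).

  The system has determinant proportional to \<open>A\<^sup>3 B - C\<close>, and its solution is the asserted one.
  What remains is to see what the sign conditions mean in terms of \<open>q = B/C\<close>, using \<open>A > 1\<close>: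
  the lower bound \<open>q > 1/A\<^sup>2\<close> makes numerator and denominator of \<open>\<beta>\<close> positive;
  \<open>\<beta> < 2 A C\<close> is \<open>A\<^sup>4 q\<^sup>2 - 2 A\<^sup>3 q + 1 < 0\<close>, whose roots are \<open>1/A \<plusminus> \<surd>(A\<^sup>2 - 1)/A\<^sup>2\<close>; and
  \<open>\<beta> \<le> 2 A\<^sup>2 B\<close> is \<open>A\<^sup>4 q\<^sup>2 - 2 A q + 1 \<ge> 0\<close>, which always holds because the discriminant is negative.
  The smaller root of the first quadratic lies below \<open>1/A\<^sup>2\<close>, so the bounds on \<open>B/C\<close> place \<open>q\<close>
  strictly between the two roots.
\<close>

text \<open>The discriminant is continuous at \<open>T\<close>, so its left limit is its value there.\<close>

lemma daniels_params_iff: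
  assumes "T > 0"
  shows "daniels_params T \<alpha> \<beta> \<gamma> \<longleftrightarrow> \<alpha> > 0 \<and> \<beta> > 0 \<and> daniels_disc \<alpha> \<beta> \<gamma> T > 0"
proof -
  have "(daniels_disc \<alpha> \<beta> \<gamma> \<longlongrightarrow> daniels_disc \<alpha> \<beta> \<gamma> T) (at_left T)"
    unfolding daniels_disc_def using assms by (intro tendsto_intros) auto
  then show ?thesis
    unfolding daniels_params_def by (metis tendsto_unique trivial_limit_at_left_real)
qed

text \<open>
  For \<open>\<gamma> \<ge> 0\<close> the discriminant is at least \<open>\<beta>\<^sup>2\<close>; for \<open>\<gamma> < 0\<close> it is nonincreasing in time. Positivity at
  the right end therefore spreads to the whole interval.
\<close>

lemma daniels_disc_pos:
  assumes "\<beta> > 0" "daniels_disc \<alpha> \<beta> \<gamma> T > 0" "0 < t" "t \<le> T"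
  shows "daniels_disc \<alpha> \<beta> \<gamma> t > 0"
proof (cases "\<gamma> \<ge> 0")
  case True
  then show ?thesis
    using assms(1) by (simp add: daniels_disc_def add_pos_nonneg)
next
  case False
  have "exp (- (\<alpha>\<^sup>2 / t)) \<le> exp (- (\<alpha>\<^sup>2 / T))"
    using assms by (simp add: frac_le)
  then have "\<gamma> * exp (- (\<alpha>\<^sup>2 / T)) \<le> \<gamma> * exp (- (\<alpha>\<^sup>2 / t))"
    using False by (intro mult_left_mono_neg) auto
  then show ?thesis
    using assms(2) by (simp add: daniels_disc_def)
qed

text \<open>The inequality \<open>\<beta> \<le> 2 * X\<close> is what singles out the larger of the two roots.\<close>

lemma larger_root_iff:
  fixes \<beta> g X :: real
  assumes "\<beta>\<^sup>2 + 4 * g \<ge> 0"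
  shows "(\<beta> + sqrt (\<beta>\<^sup>2 + 4 * g)) / 2 = X \<longleftrightarrow> \<beta> \<le> 2 * X \<and> X\<^sup>2 = \<beta> * X + g"
proof
  assume "(\<beta> + sqrt (\<beta>\<^sup>2 + 4 * g)) / 2 = X"
  then have s: "sqrt (\<beta>\<^sup>2 + 4 * g) = 2 * X - \<beta>"
    by simp
  then have "\<beta>\<^sup>2 + 4 * g = (2 * X - \<beta>)\<^sup>2"
    using assms by (metis real_sqrt_pow2)
  then have "X\<^sup>2 = \<beta> * X + g"
    by (simp add: power2_eq_square algebra_simps)
  then show "\<beta> \<le> 2 * X \<and> X\<^sup>2 = \<beta> * X + g"
    using s real_sqrt_ge_zero[OF assms] by linarith
next
  assume *: "\<beta> \<le> 2 * X \<and> X\<^sup>2 = \<beta> * X + g"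
  then have "\<beta>\<^sup>2 + 4 * g = (2 * X - \<beta>)\<^sup>2"
    by (simp add: power2_eq_square algebra_simps)
  then show "(\<beta> + sqrt (\<beta>\<^sup>2 + 4 * g)) / 2 = X"
    using * by simp
qed

lemma daniels_curve_eq_iff:
  fixes \<alpha> \<beta> \<gamma> t y :: real
  assumes "\<alpha> > 0" "\<beta> > 0" "daniels_disc \<alpha> \<beta> \<gamma> t > 0" "t > 0"
  defines "X \<equiv> exp (\<alpha> * (\<alpha> / 2 - y) / t)"
  shows "daniels_curve \<alpha> \<beta> \<gamma> t = y \<longleftrightarrow>
    \<beta> \<le> 2 * X \<and> X\<^sup>2 = \<beta> * X + \<gamma> * exp (- (\<alpha>\<^sup>2 / t))"
proof -
  define R where "R = (\<beta> + sqrt (daniels_disc \<alpha> \<beta> \<gamma> t)) / 2"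
  have "R > 0"
    using assms by (simp add: R_def add_pos_pos)
  have "daniels_curve \<alpha> \<beta> \<gamma> t = y \<longleftrightarrow> ln R = \<alpha> * (\<alpha> / 2 - y) / t"
    using assms by (auto simp: daniels_curve_def R_def[symmetric] field_simps)
  also have "\<dots> \<longleftrightarrow> R = X"
    using \<open>R > 0\<close> unfolding X_def by (metis exp_ln ln_exp)
  also have "\<dots> \<longleftrightarrow> \<beta> \<le> 2 * X \<and> X\<^sup>2 = \<beta> * X + \<gamma> * exp (- (\<alpha>\<^sup>2 / t))"
    using larger_root_iff[of \<beta> "\<gamma> * exp (- (\<alpha>\<^sup>2 / t))" X] assms(3)
    by (simp add: R_def daniels_disc_def mult.assoc)
  finally show ?thesis .
qed

text \<open>
  Positivity of the discriminant at \<open>T\<close> appears on the right as strictness of \<open>\<beta> < 2 * A * C\<close>: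
  if \<open>X\<close> is a root then the discriminant equals \<open>(2 * X - \<beta>)\<^sup>2\<close>.
\<close>

lemma daniels_through_iff_system:
  fixes T a b c A B C \<alpha> \<beta> \<gamma> :: real
  assumes "T > 0" "a > 0"
    and A: "A = exp (2 * a\<^sup>2 / T)"
    and B: "B = exp (- (4 * a * b / T))"
    and C: "C = exp (- (2 * a * c / T))"
  shows "daniels_through T {(0, a), (T / 2, b), (T, c)} (\<alpha>, \<beta>, \<gamma>) \<longleftrightarrow>
    \<alpha> = 2 * a \<and> 0 < \<beta> \<and> \<beta> < 2 * (A * C) \<and> \<beta> \<le> 2 * (A\<^sup>2 * B) \<and>
    (A * C)\<^sup>2 = \<beta> * (A * C) + \<gamma> / A\<^sup>2 \<and>
    (A\<^sup>2 * B)\<^sup>2 = \<beta> * (A\<^sup>2 * B) + \<gamma> / A ^ 4"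
proof (cases "\<alpha> = 2 * a \<and> \<beta> > 0")
  case False
  then show ?thesis
    using assms by (auto simp: daniels_through_def daniels_params_def daniels_curve_def)
next
  case True
  then have \<alpha>: "\<alpha> = 2 * a" and "\<beta> > 0" "\<alpha> > 0"
    using \<open>a > 0\<close> by auto
  have XT: "exp (\<alpha> * (\<alpha> / 2 - c) / T) = A * C"
    unfolding \<alpha> A C exp_add[symmetric]
    by (rule arg_cong[where f = exp]) (use \<open>T > 0\<close> in \<open>simp add: field_simps power2_eq_square\<close>)
  have XH: "exp (\<alpha> * (\<alpha> / 2 - b) / (T / 2)) = A\<^sup>2 * B"
    unfolding \<alpha> A B exp_add[symmetric] exp_of_nat_mult[symmetric]
    by (rule arg_cong[where f = exp]) (use \<open>T > 0\<close> in \<open>simp add: field_simps power2_eq_square\<close>)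
  have ET: "exp (- (\<alpha>\<^sup>2 / T)) = 1 / A\<^sup>2"
    unfolding \<alpha> A exp_of_nat_mult[symmetric]
    by (simp add: exp_minus inverse_eq_divide power2_eq_square)
  have EH: "exp (- (\<alpha>\<^sup>2 / (T / 2))) = 1 / A ^ 4"
    unfolding \<alpha> A exp_of_nat_mult[symmetric]
    by (simp add: exp_minus inverse_eq_divide power2_eq_square)
  have disc: "daniels_disc \<alpha> \<beta> \<gamma> T = \<beta>\<^sup>2 + 4 * \<gamma> / A\<^sup>2"
    using ET by (simp add: daniels_disc_def)
  have square: "daniels_disc \<alpha> \<beta> \<gamma> T = (2 * (A * C) - \<beta>)\<^sup>2"
    if "(A * C)\<^sup>2 = \<beta> * (A * C) + \<gamma> / A\<^sup>2"
  proof -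
    have "(2 * (A * C) - \<beta>)\<^sup>2 = 4 * (A * C)\<^sup>2 - 4 * (\<beta> * (A * C)) + \<beta>\<^sup>2"
      by (simp add: power2_diff power_mult_distrib)
    then show ?thesis
      using that disc by simp
  qed
  show ?thesis
  proof (cases "daniels_disc \<alpha> \<beta> \<gamma> T > 0")
    case False
    then show ?thesis
      using square by (auto simp: daniels_through_def daniels_params_iff[OF \<open>T > 0\<close>])
  next
    case pos: True
    have posH: "daniels_disc \<alpha> \<beta> \<gamma> (T / 2) > 0"
      using daniels_disc_pos[OF \<open>\<beta> > 0\<close> pos, of "T / 2"] \<open>T > 0\<close> by simp
    have "daniels_through T {(0, a), (T / 2, b), (T, c)} (\<alpha>, \<beta>, \<gamma>) \<longleftrightarrow>
        daniels_curve \<alpha> \<beta> \<gamma> T = c \<and> daniels_curve \<alpha> \<beta> \<gamma> (T / 2) = b"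
      using \<alpha> \<open>\<alpha> > 0\<close> \<open>\<beta> > 0\<close> pos
      by (auto simp: daniels_through_def daniels_params_iff[OF \<open>T > 0\<close>] daniels_curve_def[of _ _ _ 0])
    also have "\<dots> \<longleftrightarrow>
        (\<beta> \<le> 2 * (A * C) \<and> (A * C)\<^sup>2 = \<beta> * (A * C) + \<gamma> / A\<^sup>2) \<and>
        (\<beta> \<le> 2 * (A\<^sup>2 * B) \<and> (A\<^sup>2 * B)\<^sup>2 = \<beta> * (A\<^sup>2 * B) + \<gamma> / A ^ 4)"
      using daniels_curve_eq_iff[OF \<open>\<alpha> > 0\<close> \<open>\<beta> > 0\<close> pos \<open>T > 0\<close>, of c]
        daniels_curve_eq_iff[OF \<open>\<alpha> > 0\<close> \<open>\<beta> > 0\<close> posH, of b] \<open>T > 0\<close>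
      unfolding XT XH ET EH by simp
    finally show ?thesis
      using square pos \<alpha> \<open>\<beta> > 0\<close> by (auto simp: order_less_le)
  qed
qed

text \<open>
  Clearing denominators, both equations give \<open>\<gamma>\<close> in terms of \<open>\<beta>\<close>; equating the two expressions
  determines \<open>\<beta>\<close>.
\<close>

lemma linear_system_iff:
  fixes A B C \<beta> \<gamma> :: real
  assumes "A > 0" "A ^ 3 * B \<noteq> C"
  shows "(A * C)\<^sup>2 = \<beta> * (A * C) + \<gamma> / A\<^sup>2 \<and> (A\<^sup>2 * B)\<^sup>2 = \<beta> * (A\<^sup>2 * B) + \<gamma> / A ^ 4 \<longleftrightarrow>
    \<beta> = A * (A ^ 4 * B\<^sup>2 - C\<^sup>2) / (A ^ 3 * B - C) \<and> \<gamma> = A ^ 4 * C\<^sup>2 - \<beta> * A ^ 3 * C"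
proof -
  have 1: "(A * C)\<^sup>2 = \<beta> * (A * C) + \<gamma> / A\<^sup>2 \<longleftrightarrow> \<gamma> = A ^ 4 * C\<^sup>2 - \<beta> * A ^ 3 * C"
    using \<open>A > 0\<close> by (auto simp: field_simps power2_eq_square power3_eq_cube power4_eq_xxxx)
  have 2: "(A\<^sup>2 * B)\<^sup>2 = \<beta> * (A\<^sup>2 * B) + \<gamma> / A ^ 4 \<longleftrightarrow> \<gamma> = A ^ 8 * B\<^sup>2 - \<beta> * A ^ 6 * B"
    using \<open>A > 0\<close> by (auto simp: field_simps eval_nat_numeral)
  have "A ^ 4 * C\<^sup>2 - \<beta> * A ^ 3 * C = A ^ 8 * B\<^sup>2 - \<beta> * A ^ 6 * B \<longleftrightarrow>
      A ^ 3 * (\<beta> * (A ^ 3 * B - C)) = A ^ 3 * (A * (A ^ 4 * B\<^sup>2 - C\<^sup>2))"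
    by (auto simp: algebra_simps eval_nat_numeral)
  also have "\<dots> \<longleftrightarrow> \<beta> = A * (A ^ 4 * B\<^sup>2 - C\<^sup>2) / (A ^ 3 * B - C)"
    using assms by (simp add: eq_divide_eq)
  finally show ?thesis
    using 1 2 by auto
qed

text \<open>
  Completing the square: \<open>A\<^sup>4 q\<^sup>2 - 2 A\<^sup>3 q + 1 = (A\<^sup>2 q - A)\<^sup>2 - (A\<^sup>2 - 1)\<close>. The upper bound on \<open>q\<close>
  says \<open>A\<^sup>2 q - A < \<surd>(A\<^sup>2 - 1)\<close>, while the lower bound gives
  \<open>A - A\<^sup>2 q < A - 1 < \<surd>(A\<^sup>2 - 1)\<close>.
\<close>

lemma quadratic_neg:
  fixes A q :: real
  assumes "A > 1" "1 / A\<^sup>2 < q" "q < 1 / A + sqrt (A\<^sup>2 - 1) / A\<^sup>2"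
  shows "A ^ 4 * q\<^sup>2 - 2 * A ^ 3 * q + 1 < 0"
proof -
  have "1 < A\<^sup>2 * q" "A\<^sup>2 * q < A + sqrt (A\<^sup>2 - 1)"
    using assms by (simp_all add: field_simps power2_eq_square)
  moreover have "A - 1 \<le> sqrt (A\<^sup>2 - 1)"
    using \<open>A > 1\<close> by (intro real_le_rsqrt) (simp add: power2_eq_square algebra_simps)
  ultimately have "\<bar>A\<^sup>2 * q - A\<bar> < sqrt (A\<^sup>2 - 1)"
    by linarith
  then have "(A\<^sup>2 * q - A)\<^sup>2 < A\<^sup>2 - 1"
    using real_sqrt_less_iff[of "(A\<^sup>2 * q - A)\<^sup>2" "A\<^sup>2 - 1"] by simp
  then show ?thesis
    by (simp add: algebra_simps eval_nat_numeral)
qed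

text \<open>
  The formula for \<open>\<beta>\<close> is homogeneous: dividing by \<open>C\<close> leaves an expression in \<open>A\<close> and the ratio
  \<open>q = B / C\<close> alone, so each sign condition becomes a quadratic inequality in \<open>q\<close>.
\<close>

lemma sign_conditions:
  fixes A B C \<beta> :: real
  assumes "A > 1" "C > 0"
    and lower: "1 / A\<^sup>2 < B / C"
    and upper: "B / C < 1 / A + sqrt (A\<^sup>2 - 1) / A\<^sup>2"
    and \<beta>: "\<beta> = A * (A ^ 4 * B\<^sup>2 - C\<^sup>2) / (A ^ 3 * B - C)"
  shows "C < A ^ 3 * B" "0 < \<beta>" "\<beta> < 2 * (A * C)" "\<beta> \<le> 2 * (A\<^sup>2 * B)"
proof -
  define q where "q = B / C"
  have B: "B = q * C"
    using \<open>C > 0\<close> by (simp add: q_def)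
  have q: "1 < A\<^sup>2 * q"
    using lower \<open>A > 1\<close> by (simp add: q_def[symmetric] field_simps)
  have den: "A ^ 3 * q - 1 > 0"
    using mult_strict_mono[OF \<open>A > 1\<close> q] \<open>A > 1\<close> by (simp add: eval_nat_numeral mult.assoc)
  have \<beta>q: "\<beta> = A * C * ((A ^ 4 * q\<^sup>2 - 1) / (A ^ 3 * q - 1))"
  proof -
    have "A * (A ^ 4 * B\<^sup>2 - C\<^sup>2) = C * (A * C * (A ^ 4 * q\<^sup>2 - 1))"
      "A ^ 3 * B - C = C * (A ^ 3 * q - 1)"
      by (simp_all add: B algebra_simps power2_eq_square)
    then show ?thesis
      unfolding \<beta> using \<open>C > 0\<close> by (simp only: mult_divide_mult_cancel_left[of C]) simp
  qed
  have AC: "A * C > 0"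
    using assms by simp
  show "C < A ^ 3 * B"
    using mult_strict_left_mono[of 1 "A ^ 3 * q" C] den \<open>C > 0\<close> by (simp add: B mult_ac)
  have "1 < A ^ 4 * q\<^sup>2"
    using one_less_power[OF q, of 2] by (simp add: power_mult_distrib)
  then show "0 < \<beta>"
    unfolding \<beta>q using den AC by simp
  have "(A ^ 4 * q\<^sup>2 - 1) / (A ^ 3 * q - 1) < 2"
    using quadratic_neg[of A q] assms(1) lower upper den by (simp add: q_def[symmetric] divide_less_eq)
  then show "\<beta> < 2 * (A * C)"
    unfolding \<beta>q using mult_strict_left_mono[OF _ AC] by fastforce
  \<comment> \<open>The quadratic belonging to \<open>T / 2\<close> is a sum of two
     nonnegative terms because \<open>A > 1\<close>.\<close>
  have "(A * q - 1)\<^sup>2 + (A\<^sup>2 - 1) * (A * q)\<^sup>2 \<ge> 0"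
    using \<open>A > 1\<close> by (intro add_nonneg_nonneg mult_nonneg_nonneg) auto
  then have "A ^ 4 * q\<^sup>2 - 1 \<le> 2 * (A * q) * (A ^ 3 * q - 1)"
    by (simp add: algebra_simps eval_nat_numeral)
  then have "(A ^ 4 * q\<^sup>2 - 1) / (A ^ 3 * q - 1) \<le> 2 * (A * q)"
    using den by (simp add: divide_le_eq)
  then have "\<beta> \<le> A * C * (2 * (A * q))"
    unfolding \<beta>q using AC by (intro mult_left_mono) auto
  then show "\<beta> \<le> 2 * (A\<^sup>2 * B)"
    by (simp add: B power2_eq_square mult_ac)
qed

theorem proposition2:
  fixes T a b c A B C :: real
  assumes "T > 0" and "a > 0"
    and "A = exp (2 * a\<^sup>2 / T)"
    and "B = exp (- (4 * a * b / T))"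
    and "C = exp (- (2 * a * c / T))"
    and "1 / A\<^sup>2 < B / C"
    and "B / C < 1 / A + sqrt (A\<^sup>2 - 1) / A\<^sup>2"
  shows "(\<exists>!p. daniels_through T {(0, a), (T / 2, b), (T, c)} p) \<and>
    (\<forall>\<alpha> \<beta> \<gamma>. daniels_through T {(0, a), (T / 2, b), (T, c)} (\<alpha>, \<beta>, \<gamma>) \<longrightarrow>
       \<alpha> = 2 * a \<and>
       \<beta> = A * (A ^ 4 * B\<^sup>2 - C\<^sup>2) / (A ^ 3 * B - C) \<and>
       \<gamma> = A ^ 4 * C\<^sup>2 - \<beta> * A ^ 3 * C)"
proof -
  have "A > 1" "C > 0"
    using assms(1-3,5) by auto
  note signs = sign_conditions[OF this assms(6,7) refl]
  have "daniels_through T {(0, a), (T / 2, b), (T, c)} (\<alpha>, \<beta>, \<gamma>) \<longleftrightarrow>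
      \<alpha> = 2 * a \<and>
      \<beta> = A * (A ^ 4 * B\<^sup>2 - C\<^sup>2) / (A ^ 3 * B - C) \<and>
      \<gamma> = A ^ 4 * C\<^sup>2 - \<beta> * A ^ 3 * C" for \<alpha> \<beta> \<gamma>
    using daniels_through_iff_system[OF assms(1-5), of \<alpha> \<beta> \<gamma>] linear_system_iff[of A B C \<beta> \<gamma>]
      signs \<open>A > 1\<close> by auto
  then show ?thesis
    by auto
qed

end
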